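(* Let $F=\{f_i\}_{i=1}^k$ be a frame for $\mathcal{H}^n$, and let $\mathcal{G}=\{S_F^{-1}\theta_F^*+W : W\in\mathcal{W}_F\}$, equipped with the operation $\oplus:\mathcal{G}\times\mathcal{G}\to\mathcal{G}$ given by $(S_F^{-1}\theta_F^*+W_1)\oplus(S_F^{-1}\theta_F^*+W_2):=S_F^{-1}\theta_F^*+W_1+W_2$. Then $(\mathcal{G},\oplus)$ is an abelian group.
   Context: $\mathcal{H}^n$ denotes $\mathbb{R}^n$ or $\mathbb{C}^n$. A finite sequence $\{f_i\}_{i=1}^k$ in $\mathcal{H}^n$ is a frame for $\mathcal{H}^n$ if there are constants $A,B>0$ with $A\|f\|^2\le\sum_{i=1}^k|\langle f,f_i\rangle|^2\le B\|f\|^2$ for all $f\in\mathcal{H}^n$. The synthesis operator $\theta_F^*:\mathcal{H}^k\to\mathcal{H}^n$, $\theta_F^*(e_i)=f_i$ (with $\{e_i\}$ the standard orthonormal basis of $\mathcal{H}^k$), is identified with the $n\times k$ matrix whose columns are $f_1,\ldots,f_k$; $\theta_F$ is its adjoint, and $S_F=\theta_F^*\theta_F$ is the (invertible) frame operator. $\mathcal{W}_F$ is the set of $n\times k$ matrices $W$ (over the scalar field of $\mathcal{H}^n$) with rows $w_1,\ldots,w_n$ such that the entrywise conjugate $\overline{w}_i$, viewed as a vector in $\mathcal{H}^k$, lies in $\ker(\theta_F^* )$ for each $i$. ($\mathcal{G}$ is the set of all matrices whose columns form a dual frame of $F$.) *)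

theory Defs
  imports
    "HOL-Analysis.L2_Norm"
    "HOL-Algebra.Group"
    "Jordan_Normal_Form.Schur_Decomposition"
    "Jordan_Normal_Form.Matrix_Kernel"
begin

text \<open>
  The space H^n is \<^term>\<open>carrier_vec n\<close> over the scalar type \<^typ>\<open>real\<close> or \<^typ>\<open>complex\<close>.  The
  definitions are polymorphic so that both cases share them; \<^term>\<open>conjugate\<close> is the identity on
  \<^typ>\<open>real\<close> and \<^term>\<open>cnj\<close> on \<^typ>\<open>complex\<close>, and \<open>v \<bullet>c w\<close> is the standard inner product,
  linear in the first argument.  A finite sequence \<open>f\<^sub>1, \<dots>, f\<^sub>k\<close> is a list of length \<open>k\<close>.
\<close>

definition vec_norm2 :: "'a :: real_normed_field vec \<Rightarrow> real" where
  "vec_norm2 v = L2_set (\<lambda>j. norm (v $ j)) {..<dim_vec v}"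

definition frame :: "nat \<Rightarrow> 'a :: {conjugatable_field, real_normed_field} vec list \<Rightarrow> bool" where
  "frame n F \<longleftrightarrow> set F \<subseteq> carrier_vec n \<and>
     (\<exists>A B :: real. A > 0 \<and> B > 0 \<and>
        (\<forall>f \<in> carrier_vec n.
           A * (vec_norm2 f)\<^sup>2 \<le> (\<Sum>i<length F. (norm (f \<bullet>c (F ! i)))\<^sup>2) \<and>
           (\<Sum>i<length F. (norm (f \<bullet>c (F ! i)))\<^sup>2) \<le> B * (vec_norm2 f)\<^sup>2))"

text \<open>The synthesis operator (written \<open>\<theta>\<^sub>F\<close> with a star), as an \<open>n \<times> k\<close> matrix.\<close>

definition synthesis :: "nat \<Rightarrow> 'a :: conjugatable_field vec list \<Rightarrow> 'a mat" where
  "synthesis n F = mat_of_cols n F"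

definition analysis :: "nat \<Rightarrow> 'a :: conjugatable_field vec list \<Rightarrow> 'a mat" where
  "analysis n F = mat_adjoint (synthesis n F)"

definition frame_operator :: "nat \<Rightarrow> 'a :: conjugatable_field vec list \<Rightarrow> 'a mat" where
  "frame_operator n F = synthesis n F * analysis n F"

text \<open>The frame operator of a frame is invertible, so \<^term>\<open>mat_inverse\<close> is not \<^term>\<open>None\<close> there.\<close>

definition canonical_dual :: "nat \<Rightarrow> 'a :: conjugatable_field vec list \<Rightarrow> 'a mat" where
  "canonical_dual n F = the (mat_inverse (frame_operator n F)) * synthesis n F"

definition W_set :: "nat \<Rightarrow> 'a :: conjugatable_field vec list \<Rightarrow> 'a mat set" where
  "W_set n F = {W \<in> carrier_mat n (length F).
     \<forall>i<n. conjugate (row W i) \<in> mat_kernel (synthesis n F)}"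

definition G_set :: "nat \<Rightarrow> 'a :: conjugatable_field vec list \<Rightarrow> 'a mat set" where
  "G_set n F = {canonical_dual n F + W | W. W \<in> W_set n F}"

text \<open>
  The operation is given on representations of its arguments; the description operator turns this
  into a function, provided that the result does not depend on the representations.
\<close>

definition G_add :: "nat \<Rightarrow> 'a :: conjugatable_field vec list \<Rightarrow> 'a mat \<Rightarrow> 'a mat \<Rightarrow> 'a mat" where
  "G_add n F X Y = (THE Z. \<exists>W1 \<in> W_set n F. \<exists>W2 \<in> W_set n F.
     X = canonical_dual n F + W1 \<and> Y = canonical_dual n F + W2 \<and>
     Z = canonical_dual n F + W1 + W2)"

end

theory Submission
  imports Defs
begin

text \<open>Write C for \<open>canonical_dual n F\<close>. The set \<open>W_set n F\<close> is an
  additive subgroup of the n x k matrices, because its row condition asks for membership in a linear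
  kernel (\<open>zero_in_W_set\<close>, \<open>add_in_W_set\<close>,
  \<open>uminus_in_W_set\<close>). Adding C on the left is injective on it
  (\<open>mat_add_left_cancel\<close>), so W \<mapsto> C + W is a bijection onto
  \<open>G_set n F\<close>. The operation is therefore well defined (\<open>G_add_eq\<close>) and is
  matrix addition transported along this bijection; the abelian group structure comes with it, with
  identity C + 0 and inverse C + (- W) of C + W.\<close>

lemma synthesis_carrier [simp]: "synthesis n F \<in> carrier_mat n (length F)"
  by (simp add: synthesis_def)

lemma W_set_carrier: "W \<in> W_set n F \<Longrightarrow> W \<in> carrier_mat n (length F)"
  by (simp add: W_set_def)

lemma zero_in_W_set: "0\<^sub>m n (length F) \<in> W_set n F"
  by (auto simp: W_set_def carrier_matD[OF synthesis_carrier]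
      intro!: mat_kernelI[OF synthesis_carrier])

text \<open>Taking a row and conjugating it are both additive, and the kernel is closed under
  sums.\<close>

lemma add_in_W_set:
  assumes "W1 \<in> W_set n F" "W2 \<in> W_set n F"
  shows "W1 + W2 \<in> W_set n F"
proof -
  have "conjugate (row (W1 + W2) i) \<in> mat_kernel (synthesis n F)" if "i < n" for i
  proof -
    have c: "row W1 i \<in> carrier_vec (length F)" "row W2 i \<in> carrier_vec (length F)"
      using assms W_set_carrier \<open>i < n\<close> by (metis row_carrier_vec)+
    have k: "conjugate (row W1 i) \<in> mat_kernel (synthesis n F)"
        "conjugate (row W2 i) \<in> mat_kernel (synthesis n F)"
      using assms \<open>i < n\<close> by (auto simp: W_set_def)
    have "conjugate (row (W1 + W2) i) = conjugate (row W1 i) + conjugate (row W2 i)"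
      using assms[THEN W_set_carrier] \<open>i < n\<close> by (simp add: conjugate_add_vec[OF c])
    moreover have "synthesis n F *\<^sub>v (conjugate (row W1 i) + conjugate (row W2 i)) = 0\<^sub>v n"
      using mat_kernelD[OF synthesis_carrier k(1)] mat_kernelD[OF synthesis_carrier k(2)]
      by (subst mult_add_distrib_mat_vec[OF synthesis_carrier]) auto
    ultimately show ?thesis
      using c by (intro mat_kernelI[OF synthesis_carrier]) auto
  qed
  then show ?thesis
    using assms[THEN W_set_carrier] by (simp add: W_set_def)
qed

lemma uminus_in_W_set:
  assumes "W \<in> W_set n F"
  shows "- W \<in> W_set n F"
proof -
  have "conjugate (row (- W) i) \<in> mat_kernel (synthesis n F)" if "i < n" for i
  proof -
    have c: "row W i \<in> carrier_vec (length F)"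
      using assms W_set_carrier \<open>i < n\<close> by (metis row_carrier_vec)
    have k: "conjugate (row W i) \<in> mat_kernel (synthesis n F)"
      using assms \<open>i < n\<close> by (auto simp: W_set_def)
    \<comment> \<open>Negation is written as scaling by -1, so that linearity of the matrix-vector
      product applies.\<close>
    have "conjugate (row (- W) i) = (- 1) \<cdot>\<^sub>v conjugate (row W i)"
      using W_set_carrier[OF assms] \<open>i < n\<close> by (intro eq_vecI) (auto simp: conjugate_neg)
    moreover have "synthesis n F *\<^sub>v ((- 1) \<cdot>\<^sub>v conjugate (row W i)) = 0\<^sub>v n"
      using mat_kernelD[OF synthesis_carrier k]
      by (subst mult_mat_vec[OF synthesis_carrier]) auto
    ultimately show ?thesis
      using c by (intro mat_kernelI[OF synthesis_carrier]) auto
  qed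
  then show ?thesis
    using W_set_carrier[OF assms] by (simp add: W_set_def)
qed

text \<open>Matrix addition takes its dimensions from the right summand, so the left summand
  \<open>C\<close> may have any dimensions here.\<close>

lemma mat_add_left_cancel:
  fixes C :: "'a :: cancel_semigroup_add mat"
  assumes "W1 \<in> carrier_mat n k" "W2 \<in> carrier_mat n k" "C + W1 = C + W2"
  shows "W1 = W2"
proof (rule eq_matI)
  fix i j assume "i < dim_row W2" "j < dim_col W2"
  moreover have "(C + W1) $$ (i, j) = (C + W2) $$ (i, j)"
    using assms(3) by simp
  ultimately show "W1 $$ (i, j) = W2 $$ (i, j)"
    using assms(1,2) by simp
qed (use assms in auto)

text \<open>Brings a value of the operation into the form C + W with W = \<open>W1 + W2\<close>.
  Both sides have the dimensions of \<open>W2\<close>, and the entries there agree by associativity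
  of the scalars.\<close>

lemma mat_add_assoc:
  fixes C :: "'a :: semigroup_add mat"
  assumes "W1 \<in> carrier_mat n k" "W2 \<in> carrier_mat n k"
  shows "C + W1 + W2 = C + (W1 + W2)"
  using assms by (intro eq_matI) (auto simp: add.assoc)

text \<open>The description has a unique witness: cancelling C shows that any other representatives
  \<open>V1\<close>, \<open>V2\<close> equal \<open>W1\<close>, \<open>W2\<close>.\<close>

lemma G_add_eq:
  assumes "W1 \<in> W_set n F" "W2 \<in> W_set n F"
  shows "G_add n F (canonical_dual n F + W1) (canonical_dual n F + W2)
    = canonical_dual n F + W1 + W2"
  unfolding G_add_def
proof (rule the_equality)
  fix Z
  assume "\<exists>V1\<in>W_set n F. \<exists>V2\<in>W_set n F.
     canonical_dual n F + W1 = canonical_dual n F + V1 \<and>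
     canonical_dual n F + W2 = canonical_dual n F + V2 \<and>
     Z = canonical_dual n F + V1 + V2"
  then show "Z = canonical_dual n F + W1 + W2"
    using assms mat_add_left_cancel W_set_carrier by metis
qed (use assms in blast)

text \<open>The identity is written as C + 0 so that it has the shape on which \<open>G_add\<close>
  can be evaluated.\<close>

lemma comm_group_G_set:
  "comm_group \<lparr>carrier = G_set n F, monoid.mult = G_add n F,
     one = canonical_dual n F + 0\<^sub>m n (length F)\<rparr>"
    (is "comm_group ?G")
proof -
  let ?C = "canonical_dual n F"
  \<comment> \<open>In this form the operation adds the W parts, so each group axiom reduces to the
    same law for matrices.\<close>
  have G_add: "G_add n F (?C + V) (?C + W) = ?C + (V + W)"
    if "V \<in> W_set n F" "W \<in> W_set n F" for V W
    using that G_add_eq mat_add_assoc W_set_carrier by metis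
  have in_G: "?C + W \<in> G_set n F" if "W \<in> W_set n F" for W
    using that by (auto simp: G_set_def)
  show ?thesis
  proof (rule comm_groupI)
    fix X Y Z assume "X \<in> carrier ?G" "Y \<in> carrier ?G" "Z \<in> carrier ?G"
    then obtain U V W where [simp]: "X = ?C + U" "Y = ?C + V" "Z = ?C + W"
      and mem: "U \<in> W_set n F" "V \<in> W_set n F" "W \<in> W_set n F"
      by (auto simp: G_set_def)
    show "X \<otimes>\<^bsub>?G\<^esub> Y \<otimes>\<^bsub>?G\<^esub> Z = X \<otimes>\<^bsub>?G\<^esub> (Y \<otimes>\<^bsub>?G\<^esub> Z)"
      using mem mem[THEN W_set_carrier] by (simp add: G_add add_in_W_set assoc_add_mat)
  next
    fix X Y assume "X \<in> carrier ?G" "Y \<in> carrier ?G"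
    then obtain V W where [simp]: "X = ?C + V" "Y = ?C + W"
      and mem: "V \<in> W_set n F" "W \<in> W_set n F"
      by (auto simp: G_set_def)
    show "X \<otimes>\<^bsub>?G\<^esub> Y \<in> carrier ?G"
      using mem by (simp add: G_add in_G add_in_W_set)
    show "X \<otimes>\<^bsub>?G\<^esub> Y = Y \<otimes>\<^bsub>?G\<^esub> X"
      using mem comm_add_mat[OF mem[THEN W_set_carrier]] by (simp add: G_add)
  next
    show "\<one>\<^bsub>?G\<^esub> \<in> carrier ?G"
      by (simp add: in_G zero_in_W_set)
  next
    fix X assume "X \<in> carrier ?G"
    then obtain W where [simp]: "X = ?C + W" and mem: "W \<in> W_set n F"
      by (auto simp: G_set_def)
    show "\<one>\<^bsub>?G\<^esub> \<otimes>\<^bsub>?G\<^esub> X = X"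
      using mem W_set_carrier[OF mem] by (simp add: G_add zero_in_W_set)
    \<comment> \<open>The inverse negates only the W part and keeps C.\<close>
    have "?C + - W \<in> carrier ?G" "(?C + - W) \<otimes>\<^bsub>?G\<^esub> X = \<one>\<^bsub>?G\<^esub>"
      using mem W_set_carrier[OF mem] by (simp_all add: in_G G_add uminus_in_W_set)
    then show "\<exists>Y\<in>carrier ?G. Y \<otimes>\<^bsub>?G\<^esub> X = \<one>\<^bsub>?G\<^esub>"
      by blast
  qed
qed

theorem theorem4p1:
  shows
    "(\<forall>n (F :: real vec list). frame n F \<longrightarrow>
        (\<forall>W1 \<in> W_set n F. \<forall>W2 \<in> W_set n F.
           G_add n F (canonical_dual n F + W1) (canonical_dual n F + W2)
             = canonical_dual n F + W1 + W2) \<and>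
        (\<exists>e. comm_group \<lparr>carrier = G_set n F, monoid.mult = G_add n F, one = e\<rparr>)) \<and>
     (\<forall>n (F :: complex vec list). frame n F \<longrightarrow>
        (\<forall>W1 \<in> W_set n F. \<forall>W2 \<in> W_set n F.
           G_add n F (canonical_dual n F + W1) (canonical_dual n F + W2)
             = canonical_dual n F + W1 + W2) \<and>
        (\<exists>e. comm_group \<lparr>carrier = G_set n F, monoid.mult = G_add n F, one = e\<rparr>))"
  \<comment> \<open>\<open>exI\<close> leaves the identity schematic;
    \<open>comm_group_G_set\<close> then fixes it as C + 0, over either scalar field.\<close>
  by (intro conjI allI impI ballI exI G_add_eq; (assumption | rule comm_group_G_set))

end
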